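(* Let $(F,\Phi,\Psi)$ be a Drinfeld twist on a set-theoretical YBE solution $(X,r)$. Then $(X, F r F^{-1})$ is a set-theoretical YBE solution.
   Context: For a set $X$ and a map $r:X^2\to X^2$, write $r_{12}=r\times \mathrm{id}_X$ and $r_{23}=\mathrm{id}_X\times r$ as maps $X^3\to X^3$. A set-theoretical YBE solution $(X,r)$ is a set $X$ with an invertible map $r:X^2\to X^2$ satisfying $r_{23}r_{12}r_{23}=r_{12}r_{23}r_{12}$. A Drinfeld twist on $(X,r)$ is a triple of invertible maps $F:X^2\to X^2$ and $\Phi,\Psi:X^3\to X^3$ satisfying (T1) $(F\times\mathrm{id}_X)\Psi=(\mathrm{id}_X\times F)\Phi$, (T2) $\Phi(\mathrm{id}_X\times r)=(\mathrm{id}_X\times r)\Phi$, (T3) $\Psi(r\times\mathrm{id}_X)=(r\times \mathrm{id}_X)\Psi$. Juxtaposition of maps denotes composition. *)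

theory Defs
  imports Main
begin

text \<open>
  The underlying set is a carrier \<^term>\<open>X\<close>, possibly empty, inside a type. Maps between powers of
  \<^term>\<open>X\<close> are HOL functions of which only the values on the relevant power matter, so equalities of
  maps are equalities of values on the carrier, and invertibility is \<^const>\<open>bij_betw\<close> of the
  carrier with itself. The cube of \<^term>\<open>X\<close> is \<^term>\<open>X \<times> X \<times> X\<close>, a set of right-nested pairs.
\<close>

text \<open>\<open>on12 f\<close> is f x id and \<open>on23 f\<close> is id x f. The former
  is not a plain \<^const>\<open>map_prod\<close> because triples associate to the right.\<close>

definition on12 :: "('a \<times> 'a \<Rightarrow> 'a \<times> 'a) \<Rightarrow> 'a \<times> 'a \<times> 'a \<Rightarrow> 'a \<times> 'a \<times> 'a" where
  "on12 f = (\<lambda>(x, y, z). (fst (f (x, y)), snd (f (x, y)), z))"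

definition on23 :: "('a \<times> 'a \<Rightarrow> 'a \<times> 'a) \<Rightarrow> 'a \<times> 'a \<times> 'a \<Rightarrow> 'a \<times> 'a \<times> 'a" where
  "on23 f = map_prod id f"

definition ybe_solution :: "'a set \<Rightarrow> ('a \<times> 'a \<Rightarrow> 'a \<times> 'a) \<Rightarrow> bool" where
  "ybe_solution X r \<longleftrightarrow>
     bij_betw r (X \<times> X) (X \<times> X) \<and>
     (\<forall>t \<in> X \<times> X \<times> X. (on23 r \<circ> on12 r \<circ> on23 r) t = (on12 r \<circ> on23 r \<circ> on12 r) t)"

definition drinfeld_twist ::
  "'a set \<Rightarrow> ('a \<times> 'a \<Rightarrow> 'a \<times> 'a) \<Rightarrow> ('a \<times> 'a \<Rightarrow> 'a \<times> 'a) \<Rightarrow>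
   ('a \<times> 'a \<times> 'a \<Rightarrow> 'a \<times> 'a \<times> 'a) \<Rightarrow> ('a \<times> 'a \<times> 'a \<Rightarrow> 'a \<times> 'a \<times> 'a) \<Rightarrow> bool" where
  "drinfeld_twist X r F \<Phi> \<Psi> \<longleftrightarrow>
     bij_betw F (X \<times> X) (X \<times> X) \<and>
     bij_betw \<Phi> (X \<times> X \<times> X) (X \<times> X \<times> X) \<and>
     bij_betw \<Psi> (X \<times> X \<times> X) (X \<times> X \<times> X) \<and>
     (\<forall>t \<in> X \<times> X \<times> X. (on12 F \<circ> \<Psi>) t = (on23 F \<circ> \<Phi>) t) \<and>
     (\<forall>t \<in> X \<times> X \<times> X. (\<Phi> \<circ> on23 r) t = (on23 r \<circ> \<Phi>) t) \<and>
     (\<forall>t \<in> X \<times> X \<times> X. (\<Psi> \<circ> on12 r) t = (on12 r \<circ> \<Psi>) t)"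

end

theory Submission
  imports Defs
begin

text \<open>
  By (T1), the maps F_12 \<Psi> and F_23 \<Phi> are one and the same bijection G of the cube. Write s for
  F r F^{-1}, so that s F = F r. As \<Psi> commutes with r_12 and \<Phi> with r_23, the first expression for G
  gives s_12 G = G r_12 and the second gives s_23 G = G r_23. Thus a single G conjugates both
  factors of the braid relation for r into those for s, and since G is onto, the relation carries
  over to the whole cube (lemma \<open>braid_relation_transport\<close>).
\<close>

lemma on12_mem:
  assumes "f ` (X \<times> X) \<subseteq> X \<times> X" "t \<in> X \<times> X \<times> X"
  shows "on12 f t \<in> X \<times> X \<times> X"
proof -
  obtain x y z where t: "t = (x, y, z)" "x \<in> X" "y \<in> X" "z \<in> X"
    using assms(2) by auto
  then have "f (x, y) \<in> X \<times> X"
    using assms(1) by blast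
  then show ?thesis
    using t by (simp add: on12_def mem_Times_iff)
qed

lemma on23_mem:
  assumes "f ` (X \<times> X) \<subseteq> X \<times> X" "t \<in> X \<times> X \<times> X"
  shows "on23 f t \<in> X \<times> X \<times> X"
  using assms unfolding on23_def by (cases t) auto

lemma on23_image: "on23 f ` (X \<times> X \<times> X) = X \<times> f ` (X \<times> X)"
  unfolding on23_def by (auto simp: map_prod_surj_on)

lemma on12_intertwine:
  assumes "\<And>p. p \<in> X \<times> X \<Longrightarrow> s (F p) = F (r p)" "t \<in> X \<times> X \<times> X"
  shows "on12 s (on12 F t) = on12 F (on12 r t)"
  using assms by (cases t) (simp add: on12_def)

lemma on23_intertwine:
  assumes "\<And>p. p \<in> X \<times> X \<Longrightarrow> s (F p) = F (r p)" "t \<in> X \<times> X \<times> X"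
  shows "on23 s (on23 F t) = on23 F (on23 r t)"
  using assms by (cases t) (simp add: on23_def)

text \<open>
  Each side of the relation for c and d, evaluated at G t, is G of the corresponding side for a and
  b at t: push G leftwards through one factor at a time. Surjectivity of G makes points of this form
  exhaust T.
\<close>

lemma braid_relation_transport:
  assumes onto: "G ` S = T"
    and a: "\<And>t. t \<in> S \<Longrightarrow> a t \<in> S" and b: "\<And>t. t \<in> S \<Longrightarrow> b t \<in> S"
    and c: "\<And>t. t \<in> S \<Longrightarrow> c (G t) = G (a t)" and d: "\<And>t. t \<in> S \<Longrightarrow> d (G t) = G (b t)"
    and braid: "\<And>t. t \<in> S \<Longrightarrow> b (a (b t)) = a (b (a t))"
    and u: "u \<in> T"
  shows "d (c (d u)) = c (d (c u))"
proof -
  obtain t where "t \<in> S" "u = G t"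
    using onto u by blast
  then show ?thesis
    by (simp add: a b c d braid)
qed

theorem theorem2p1:
  fixes X :: "'a set"
    and r F :: "'a \<times> 'a \<Rightarrow> 'a \<times> 'a"
    and \<Phi> \<Psi> :: "'a \<times> 'a \<times> 'a \<Rightarrow> 'a \<times> 'a \<times> 'a"
  assumes "ybe_solution X r"
    and "drinfeld_twist X r F \<Phi> \<Psi>"
  shows "ybe_solution X (F \<circ> r \<circ> inv_into (X \<times> X) F)"
proof -
  define s where "s = F \<circ> r \<circ> inv_into (X \<times> X) F"
  define G where "G = on23 F \<circ> \<Phi>"
  let ?C = "X \<times> X \<times> X"
  have r: "bij_betw r (X \<times> X) (X \<times> X)"
    and braid: "\<And>t. t \<in> ?C \<Longrightarrow> on23 r (on12 r (on23 r t)) = on12 r (on23 r (on12 r t))"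
    using assms(1) by (auto simp: ybe_solution_def)
  have F: "bij_betw F (X \<times> X) (X \<times> X)"
    and \<Phi>: "bij_betw \<Phi> ?C ?C" and \<Psi>: "bij_betw \<Psi> ?C ?C"
    and T1: "\<And>t. t \<in> ?C \<Longrightarrow> on12 F (\<Psi> t) = G t"
    and T2: "\<And>t. t \<in> ?C \<Longrightarrow> \<Phi> (on23 r t) = on23 r (\<Phi> t)"
    and T3: "\<And>t. t \<in> ?C \<Longrightarrow> \<Psi> (on12 r t) = on12 r (\<Psi> t)"
    using assms(2) by (auto simp: drinfeld_twist_def G_def)
  have r_into: "r ` (X \<times> X) \<subseteq> X \<times> X"
    using r by (simp add: bij_betw_def)
  have s: "bij_betw s (X \<times> X) (X \<times> X)"
    unfolding s_def using F r by (auto intro: bij_betw_trans bij_betw_inv_into)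
  have sF: "s (F p) = F (r p)" if "p \<in> X \<times> X" for p
    using that F by (simp add: s_def bij_betw_inv_into_left)
  have onto: "G ` ?C = ?C"
  proof -
    have "G ` ?C = on23 F ` (\<Phi> ` ?C)"
      by (simp only: G_def image_comp)
    also have "\<dots> = ?C"
      using F \<Phi> by (simp add: bij_betw_def on23_image)
    finally show ?thesis .
  qed
  have G12: "on12 s (G t) = G (on12 r t)" if t: "t \<in> ?C" for t
  proof -
    have "on12 s (G t) = on12 F (on12 r (\<Psi> t))"
      using on12_intertwine[of X s F r, OF sF bij_betwE[OF \<Psi>, rule_format, OF t]] T1[OF t] by simp
    also have "\<dots> = G (on12 r t)"
      using T3[OF t] T1[OF on12_mem[OF r_into t]] by simp
    finally show ?thesis .
  qed
  have G23: "on23 s (G t) = G (on23 r t)" if t: "t \<in> ?C" for t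
    using on23_intertwine[of X s F r, OF sF bij_betwE[OF \<Phi>, rule_format, OF t]] T2[OF t]
    by (simp add: G_def)
  have "on23 s (on12 s (on23 s u)) = on12 s (on23 s (on12 s u))" if "u \<in> ?C" for u
    using onto on12_mem[OF r_into] on23_mem[OF r_into] G12 G23 braid that
    by (rule braid_relation_transport)
  then show ?thesis
    using s unfolding s_def[symmetric] by (simp add: ybe_solution_def)
qed

end
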